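(* Let $N,n\ge 1$ be integers, $\mathcal{N}=\{1,\ldots,N\}$, and $\alpha_i\in\mathbb{R}_{>0}$ for $i\in\mathcal{N}$. Let $\boldsymbol{\mathcal{G}}_i:\mathcal{L}_{2e}\to\mathcal{L}_{2e}$, $i\in\mathcal{N}$, be square systems ($n$ inputs, $n$ outputs), and let $\boldsymbol{\Phi}_i(t)\in\mathbb{R}^{n\times n}$, $t\ge 0$, $i\in\mathcal{N}$, be bounded scheduling matrices. Let $\bar{\boldsymbol{\mathcal{G}}}$ be the gain-scheduled controller $\mathbf{u}_{\mathrm{c}}\mapsto\mathbf{y}_{\mathrm{c}}$ defined by $$\mathbf{u}_i(t)=\boldsymbol{\Phi}_i(t)\mathbf{u}_{\mathrm{c}}(t),\qquad \mathbf{y}_i(t)=(\boldsymbol{\mathcal{G}}_i\mathbf{u}_i)(t),\qquad \mathbf{y}_{\mathrm{c}}(t)=\sum_{i\in\mathcal{N}}\alpha_i\boldsymbol{\Phi}_i^{\top}(t)\mathbf{y}_i(t).$$ If each subcontroller $\boldsymbol{\mathcal{G}}_i$ is output strictly passive (OSP) and the scheduling matrices are active, then $\bar{\boldsymbol{\mathcal{G}}}$ is OSP.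
   Context: Signals are piecewise continuous functions $\mathbf{u}:\mathbb{R}_{\ge 0}\to\mathbb{R}^n$. For $T\in\mathbb{R}_{\ge 0}$, $\langle\mathbf{u},\mathbf{y}\rangle_T=\int_0^T\mathbf{u}^{\top}(t)\mathbf{y}(t)\,dt$ and $\|\mathbf{u}\|_{2T}=\sqrt{\langle\mathbf{u},\mathbf{u}\rangle_T}$. $\mathbf{u}\in\mathcal{L}_{2e}$ if $\|\mathbf{u}\|_{2T}<\infty$ for all $T\in\mathbb{R}_{\ge 0}$. OSP: a square system with input $\mathbf{u}\in\mathcal{L}_{2e}$ and output $\mathbf{y}\in\mathcal{L}_{2e}$ mapped through the operator $\boldsymbol{\mathcal{G}}:\mathcal{L}_{2e}\to\mathcal{L}_{2e}$ is OSP if there exist constants $\beta\in\mathbb{R}_{\le 0}$ and $\varepsilon\in\mathbb{R}_{>0}$ such that $\langle\mathbf{u},\mathbf{y}\rangle_T\ge\beta+\varepsilon\|\mathbf{y}\|_{2T}^2$ for all $\mathbf{u}\in\mathcal{L}_{2e}$ and all $T\in\mathbb{R}_{\ge 0}$. The scheduling matrices may depend on external signals $\boldsymbol{\zeta}(t)$ and plant states $\mathbf{x}(t)$; $\boldsymbol{\Phi}_i(t)$ abbreviates $\boldsymbol{\Phi}_i(\boldsymbol{\zeta}(t),\mathbf{x}(t),t)$. Active: at all times there exists at least one nonzero scheduling matrix, i.e., for $T\in\mathbb{R}_{\ge 0}$ and all $t\in[0,T]$ there exists $i\in\mathcal{N}$ such that $\boldsymbol{\Phi}_i(t)\ne\mathbf{0}$.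 Bounded: $\sup_{t\in[0,T]}\|\boldsymbol{\Phi}_i(t)\|_2^2<\infty$ for all $i\in\mathcal{N}$ and $T\in\mathbb{R}_{\ge 0}$, where $\|\cdot\|_2$ is the induced matrix $2$-norm (largest singular value).
   Formalization: The scheduling matrices are assumed bounded uniformly on [0,∞), not just on each [0,T] (otherwise false: N=n=1, G=identity, Φ(t)=1+t), and piecewise continuous in t, so that each Φ_i u_c is an admissible signal. *)

theory Defs
  imports "HOL-Analysis.Analysis"
begin

text \<open>
  A function on the nonnegative reals is represented by a total function on \<^typ>\<open>real\<close>;
  none of the notions below looks at its values at negative times.
\<close>

definition piecewise_continuous :: "(real \<Rightarrow> 'a::topological_space) \<Rightarrow> bool" where
  "piecewise_continuous f \<longleftrightarrow>
     (\<forall>T\<ge>0. finite {t \<in> {0..T}. \<not> continuous (at t within {0..}) f}) \<and>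
     (\<forall>t\<ge>0. \<exists>l. (f \<longlongrightarrow> l) (at_right t)) \<and>
     (\<forall>t>0. \<exists>l. (f \<longlongrightarrow> l) (at_left t))"

definition trunc_inner :: "real \<Rightarrow> (real \<Rightarrow> real^'n) \<Rightarrow> (real \<Rightarrow> real^'n) \<Rightarrow> real" where
  "trunc_inner T u y = integral {0..T} (\<lambda>t. u t \<bullet> y t)"

definition trunc_norm :: "real \<Rightarrow> (real \<Rightarrow> real^'n) \<Rightarrow> real" where
  "trunc_norm T u = sqrt (trunc_inner T u u)"

text \<open>
  Finiteness of the truncated norm is integrability of the nonnegative integrand, since
  \<^const>\<open>integral\<close> is \<open>0\<close> for functions that are not integrable.
\<close>

definition L2e :: "(real \<Rightarrow> real^'n) set" where
  "L2e = {u. piecewise_continuous u \<and> (\<forall>T\<ge>0. (\<lambda>t. u t \<bullet> u t) integrable_on {0..T})}"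

definition OSP :: "((real \<Rightarrow> real^'n) \<Rightarrow> (real \<Rightarrow> real^'n)) \<Rightarrow> bool" where
  "OSP G \<longleftrightarrow> G \<in> L2e \<rightarrow> L2e \<and>
     (\<exists>\<beta>\<le>0. \<exists>\<epsilon>>0. \<forall>u\<in>L2e. \<forall>T\<ge>0.
        trunc_inner T u (G u) \<ge> \<beta> + \<epsilon> * (trunc_norm T (G u))\<^sup>2)"

definition scheduling_active :: "nat \<Rightarrow> (nat \<Rightarrow> real \<Rightarrow> real^'n^'n) \<Rightarrow> bool" where
  "scheduling_active N \<Phi> \<longleftrightarrow> (\<forall>T\<ge>0. \<forall>t\<in>{0..T}. \<exists>i\<in>{1..N}. \<Phi> i t \<noteq> 0)"

text \<open>
  The bound on the induced 2-norm is uniform in the horizon, i.e. one bound serves all intervals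
  \<open>{0..T}\<close>.  This is needed because the constants in \<^const>\<open>OSP\<close> do not depend on \<open>T\<close>: if the
  bound may depend on \<open>T\<close>, the scalar gain \<open>\<Phi> 1 t = 1 + t\<close> with \<open>N = 1\<close> and \<open>G 1\<close> the identity is
  active and bounded on each \<open>{0..T}\<close>, but \<open>u \<mapsto> (1 + t)\<^sup>2 u\<close> is not output strictly passive.
\<close>

definition scheduling_bounded :: "nat \<Rightarrow> (nat \<Rightarrow> real \<Rightarrow> real^'n^'n) \<Rightarrow> bool" where
  "scheduling_bounded N \<Phi> \<longleftrightarrow>
     (\<forall>i\<in>{1..N}. \<exists>M. \<forall>T\<ge>0. \<forall>t\<in>{0..T}. (onorm ((*v) (\<Phi> i t)))\<^sup>2 \<le> M)"

definition gain_scheduled ::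
    "nat \<Rightarrow> (nat \<Rightarrow> real) \<Rightarrow> (nat \<Rightarrow> real \<Rightarrow> real^'n^'n)
      \<Rightarrow> (nat \<Rightarrow> (real \<Rightarrow> real^'n) \<Rightarrow> (real \<Rightarrow> real^'n))
      \<Rightarrow> (real \<Rightarrow> real^'n) \<Rightarrow> (real \<Rightarrow> real^'n)" where
  "gain_scheduled N \<alpha> \<Phi> G u =
     (\<lambda>t. \<Sum>i\<in>{1..N}. \<alpha> i *\<^sub>R (transpose (\<Phi> i t) *v G i (\<lambda>s. \<Phi> i s *v u s) t))"

end

theory Submission
  imports Defs
begin

text \<open>
  Since \<open>u \<bullet> \<Phi>\<^sub>i\<^sup>T y\<^sub>i = \<Phi>\<^sub>i u \<bullet> y\<^sub>i\<close>, the supply rate of the scheduled controller is the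
  \<open>\<alpha>\<close>-weighted sum of the supply rates of the subcontrollers, hence at least
  \<open>\<Sum>\<^sub>i \<alpha>\<^sub>i (\<beta>\<^sub>i + \<epsilon>\<^sub>i \<parallel>y\<^sub>i\<parallel>\<^sup>2)\<close>.  Because the \<open>\<Phi>\<^sub>i\<close> are bounded, Cauchy--Schwarz gives
  \<open>\<bar>y\<^sub>c\<bar>\<^sup>2 \<le> C \<Sum>\<^sub>i \<alpha>\<^sub>i \<epsilon>\<^sub>i \<bar>y\<^sub>i\<bar>\<^sup>2\<close> pointwise, so \<open>1 / C\<close> serves as passivity index.
\<close>

section \<open>Closure properties of piecewise continuous functions\<close>

lemma piecewise_continuous_Pair:
  assumes f: "piecewise_continuous f" and g: "piecewise_continuous g"
  shows "piecewise_continuous (\<lambda>t. (f t, g t))"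
  unfolding piecewise_continuous_def
proof (intro conjI allI impI)
  fix T :: real assume "T \<ge> 0"
  then have "finite ({t \<in> {0..T}. \<not> continuous (at t within {0..}) f} \<union>
      {t \<in> {0..T}. \<not> continuous (at t within {0..}) g})"
    using f g unfolding piecewise_continuous_def by blast
  then show "finite {t \<in> {0..T}. \<not> continuous (at t within {0..}) (\<lambda>t. (f t, g t))}"
    by (rule rev_finite_subset) (auto intro: continuous_Pair)
next
  fix t :: real assume "t \<ge> 0"
  then obtain k l where "(f \<longlongrightarrow> k) (at_right t)" "(g \<longlongrightarrow> l) (at_right t)"
    using f g unfolding piecewise_continuous_def by blast
  then show "\<exists>l. ((\<lambda>t. (f t, g t)) \<longlongrightarrow> l) (at_right t)"
    by (blast intro: tendsto_Pair)
next
  fix t :: real assume "t > 0"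
  then obtain k l where "(f \<longlongrightarrow> k) (at_left t)" "(g \<longlongrightarrow> l) (at_left t)"
    using f g unfolding piecewise_continuous_def by blast
  then show "\<exists>l. ((\<lambda>t. (f t, g t)) \<longlongrightarrow> l) (at_left t)"
    by (blast intro: tendsto_Pair)
qed

lemma piecewise_continuous_compose:
  assumes f: "piecewise_continuous f" and h: "continuous_on UNIV h"
  shows "piecewise_continuous (\<lambda>t. h (f t))"
  unfolding piecewise_continuous_def
proof (intro conjI allI impI)
  \<comment> \<open>The filter is arbitrary so that one fact covers both the points of continuity of
    \<open>f\<close> and its two kinds of one-sided limits.\<close>
  have lim: "((\<lambda>t. h (f t)) \<longlongrightarrow> h l) F" if "(f \<longlongrightarrow> l) F" for l F
    using continuous_on_tendsto_compose[OF h that] by simp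
  {
    fix T :: real assume "T \<ge> 0"
    then have "finite {t \<in> {0..T}. \<not> continuous (at t within {0..}) f}"
      using f unfolding piecewise_continuous_def by blast
    then show "finite {t \<in> {0..T}. \<not> continuous (at t within {0..}) (\<lambda>t. h (f t))}"
      by (rule rev_finite_subset) (auto simp: continuous_within intro: lim)
  next
    fix t :: real assume "t \<ge> 0"
    then show "\<exists>l. ((\<lambda>t. h (f t)) \<longlongrightarrow> l) (at_right t)"
      using f lim unfolding piecewise_continuous_def by meson
  next
    fix t :: real assume "t > 0"
    then show "\<exists>l. ((\<lambda>t. h (f t)) \<longlongrightarrow> l) (at_left t)"
      using f lim unfolding piecewise_continuous_def by meson
  }
qed

text \<open>Pairing \<open>f\<close> with \<open>g\<close> reduces a jointly continuous binary
  operation to the unary composition rule. Sums, inner products and matrix-vector products are all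
  treated this way.\<close>

lemma piecewise_continuous_compose2:
  assumes "piecewise_continuous f" "piecewise_continuous g"
    and "continuous_on UNIV (\<lambda>p. h (fst p) (snd p))"
  shows "piecewise_continuous (\<lambda>t. h (f t) (g t))"
  using piecewise_continuous_compose[OF piecewise_continuous_Pair[OF assms(1,2)] assms(3)]
  by simp

lemma piecewise_continuous_const: "piecewise_continuous (\<lambda>t. c)"
  unfolding piecewise_continuous_def by auto

lemma piecewise_continuous_sum:
  fixes f :: "'i \<Rightarrow> real \<Rightarrow> 'a::real_normed_vector"
  assumes "\<And>i. i \<in> I \<Longrightarrow> piecewise_continuous (f i)"
  shows "piecewise_continuous (\<lambda>t. \<Sum>i\<in>I. f i t)"
  using assms
proof (induction I rule: infinite_finite_induct)
  case (insert i I)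
  have "piecewise_continuous (\<lambda>t. f i t + (\<Sum>j\<in>I. f j t))"
    by (rule piecewise_continuous_compose2[where h = "(+)"])
      (use insert in \<open>auto intro!: continuous_intros\<close>)
  then show ?case using insert by simp
\<comment> \<open>A sum over an infinite index set is 0 by convention, so the infinite case and the
  empty case both concern a constant function.\<close>
qed (auto simp: piecewise_continuous_const)

lemma continuous_on_matrix_vector_mult [continuous_intros]:
  fixes A :: "'a::topological_space \<Rightarrow> real^'n^'m"
  assumes "continuous_on S A" "continuous_on S x"
  shows "continuous_on S (\<lambda>p. A p *v x p)"
  unfolding matrix_vector_mult_def by (intro continuous_intros assms)

lemma continuous_on_transpose [continuous_intros]:
  fixes A :: "'a::topological_space \<Rightarrow> real^'n^'m"
  assumes "continuous_on S A"
  shows "continuous_on S (\<lambda>p. transpose (A p))"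
  unfolding transpose_def by (intro continuous_intros assms)

section \<open>Integrability and membership in \<open>L2e\<close> by domination\<close>

text \<open>Away from its finitely many discontinuities in the interval, \<open>f\<close> is
  continuous and hence measurable, so domination by \<open>g\<close> gives integrability there. The
  exceptional points form a negligible set and may be restored.\<close>

lemma integrable_on_piecewise_continuous_bounded:
  fixes f :: "real \<Rightarrow> 'a::euclidean_space"
  assumes f: "piecewise_continuous f" and T: "T \<ge> 0"
    and g: "g integrable_on {0..T}" and le: "\<And>t. t \<in> {0..T} \<Longrightarrow> norm (f t) \<le> g t"
  shows "f integrable_on {0..T}"
proof -
  define F where "F = {t \<in> {0..T}. \<not> continuous (at t within {0..}) f}"
  have F: "finite F"
    using f T unfolding piecewise_continuous_def F_def by blast
  then have neg: "negligible F" by (rule negligible_finite)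
  have "continuous_on ({0..T} - F) f"
    unfolding continuous_on_eq_continuous_within F_def
    by (auto intro: continuous_within_subset)
  moreover have meas: "{0..T} - F \<in> sets lebesgue"
    by (intro sets.Diff negligible_imp_sets[OF neg]) auto
  ultimately have "f \<in> borel_measurable (lebesgue_on ({0..T} - F))"
    by (intro continuous_imp_measurable_on_sets_lebesgue)
  moreover have "g integrable_on {0..T} - F"
    by (rule integrable_spike_set[OF g]) (auto intro: negligible_subset[OF neg])
  ultimately have "f integrable_on {0..T} - F"
    by (rule measurable_bounded_by_integrable_imp_integrable) (use le meas in auto)
  then show ?thesis
    by (rule integrable_spike_set) (auto intro: negligible_subset[OF neg])
qed

lemma L2e_D:
  assumes "u \<in> L2e"
  shows L2e_piecewise_continuous: "piecewise_continuous u"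
    and L2e_integrable: "T \<ge> 0 \<Longrightarrow> (\<lambda>t. u t \<bullet> u t) integrable_on {0..T}"
  using assms unfolding L2e_def by auto

lemma L2e_inner_integrable:
  assumes u: "u \<in> L2e" and y: "y \<in> L2e" and T: "T \<ge> 0"
  shows "(\<lambda>t. u t \<bullet> y t) integrable_on {0..T}"
proof (rule integrable_on_piecewise_continuous_bounded[OF _ T])
  show "piecewise_continuous (\<lambda>t. u t \<bullet> y t)"
    by (rule piecewise_continuous_compose2[where h = "(\<bullet>)", OF u[THEN L2e_piecewise_continuous]
          y[THEN L2e_piecewise_continuous]]) (intro continuous_intros)
  show "(\<lambda>t. u t \<bullet> u t + y t \<bullet> y t) integrable_on {0..T}"
    by (intro integrable_add L2e_integrable u y T)
  show "norm (u t \<bullet> y t) \<le> u t \<bullet> u t + y t \<bullet> y t" for t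
  proof -
    \<comment> \<open>Expanding the two squares bounds twice the inner product, with either sign, by
      \<open>u t \<bullet> u t + y t \<bullet> y t\<close>. The last two facts allow the spare
      factor 1/2 to be dropped.\<close>
    have "0 \<le> (u t + y t) \<bullet> (u t + y t)" "0 \<le> (u t - y t) \<bullet> (u t - y t)"
      "0 \<le> u t \<bullet> u t" "0 \<le> y t \<bullet> y t"
      by (rule inner_ge_zero)+
    then show ?thesis
      by (simp add: inner_add_left inner_add_right inner_diff_left inner_diff_right
          inner_commute[of "y t" "u t"])
  qed
qed

text \<open>Piecewise continuity already supplies measurability, so a pointwise comparison with a
  locally integrable function is enough. This serves for the scheduled inputs as well as for the
  combined output.\<close>

lemma L2e_I:
  fixes u :: "real \<Rightarrow> real^'n"
  assumes u: "piecewise_continuous u"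
    and g: "\<And>T. T \<ge> 0 \<Longrightarrow> g integrable_on {0..T}"
    and le: "\<And>t. t \<ge> 0 \<Longrightarrow> u t \<bullet> u t \<le> g t"
  shows "u \<in> L2e"
  unfolding L2e_def
proof (intro CollectI conjI allI impI u)
  fix T :: real assume T: "T \<ge> 0"
  show "(\<lambda>t. u t \<bullet> u t) integrable_on {0..T}"
    by (rule integrable_on_piecewise_continuous_bounded[OF _ T g[OF T]])
      (use le in \<open>auto intro!: piecewise_continuous_compose[OF u] continuous_intros\<close>)
qed

lemma trunc_norm_power2:
  assumes "u \<in> L2e" "T \<ge> 0"
  shows "(trunc_norm T u)\<^sup>2 = integral {0..T} (\<lambda>t. u t \<bullet> u t)"
  using integral_nonneg[OF L2e_integrable[OF assms]]
  by (simp add: trunc_norm_def trunc_inner_def)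

section \<open>Norm estimates for transposed matrices and finite sums\<close>

lemma inner_transpose_mult:
  fixes A :: "real^'n^'m"
  shows "x \<bullet> (transpose A *v y) = (A *v x) \<bullet> y"
  by (metis dot_lmul_matrix inner_commute transpose_matrix_vector)

text \<open>Transposition does not increase the induced norm: for
  \<open>w = transpose A *v y\<close>, the square of \<open>norm w\<close> equals
  \<open>y \<bullet> (A *v w)\<close>. Cauchy-Schwarz followed by division by \<open>norm w\<close>
  gives the bound, which is why \<open>w = 0\<close> is treated apart.\<close>

lemma norm_transpose_mult_le:
  fixes A :: "real^'n^'m"
  shows "norm (transpose A *v y) \<le> onorm ((*v) A) * norm y"
proof (cases "transpose A *v y = 0")
  case True
  then show ?thesis
    by (simp add: onorm_pos_le)
next
  case False
  let ?w = "transpose A *v y"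
  have "norm ?w * norm ?w = ?w \<bullet> ?w"
    by (simp add: dot_square_norm power2_eq_square)
  also have "\<dots> = y \<bullet> (A *v ?w)"
    by (simp only: inner_transpose_mult inner_commute)
  also have "\<dots> \<le> norm y * norm (A *v ?w)"
    by (rule norm_cauchy_schwarz)
  also have "\<dots> \<le> norm y * (onorm ((*v) A) * norm ?w)"
    by (intro mult_left_mono onorm) auto
  finally have "norm ?w * norm ?w \<le> (onorm ((*v) A) * norm y) * norm ?w"
    by (simp add: mult_ac)
  then show ?thesis
    using False by (simp add: mult_le_cancel_right)
qed

text \<open>The triangle inequality reduces this to Cauchy-Schwarz against the constant vector of
  ones, whence the factor \<open>card I\<close>.\<close>

lemma norm_sum_power2_le:
  fixes f :: "'i \<Rightarrow> 'a::real_normed_vector"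
  shows "(norm (sum f I))\<^sup>2 \<le> card I * (\<Sum>i\<in>I. (norm (f i))\<^sup>2)"
proof -
  have "(norm (sum f I))\<^sup>2 \<le> (\<Sum>i\<in>I. norm (f i))\<^sup>2"
    by (intro power_mono norm_sum) auto
  also have "\<dots> \<le> (\<Sum>i\<in>I. (norm (f i))\<^sup>2) * card I"
    by (rule sum_squared_le_sum_of_squares)
  finally show ?thesis by (simp add: mult_ac)
qed

section \<open>Output strict passivity of the scheduled controller\<close>

theorem theorem2:
  fixes N :: nat
    and \<alpha> :: "nat \<Rightarrow> real"
    and \<Phi> :: "nat \<Rightarrow> real \<Rightarrow> real^'n^'n"
    and G :: "nat \<Rightarrow> (real \<Rightarrow> real^'n) \<Rightarrow> (real \<Rightarrow> real^'n)"
  assumes "N \<ge> 1"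
    and "\<And>i. i \<in> {1..N} \<Longrightarrow> \<alpha> i > 0"
    and "\<And>i. i \<in> {1..N} \<Longrightarrow> piecewise_continuous (\<Phi> i)"
    and "scheduling_bounded N \<Phi>"
    and "scheduling_active N \<Phi>"
    and "\<And>i. i \<in> {1..N} \<Longrightarrow> OSP (G i)"
  shows "OSP (gain_scheduled N \<alpha> \<Phi> G)"
proof -
  note \<alpha> = assms(2) and pc = assms(3)
  let ?I = "{1..N}"
  \<comment> \<open>Each bound \<open>M i\<close> is independent of the horizon, so it holds at
    every nonnegative time. This keeps the final passivity constants independent of
    \<open>T\<close>.\<close>
  obtain M where M: "\<And>i t. i \<in> ?I \<Longrightarrow> t \<ge> 0 \<Longrightarrow> (onorm ((*v) (\<Phi> i t)))\<^sup>2 \<le> M i"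
  proof -
    have "\<forall>i\<in>?I. \<exists>M. \<forall>T\<ge>0. \<forall>t\<in>{0..T}. (onorm ((*v) (\<Phi> i t)))\<^sup>2 \<le> M"
      using assms(4) unfolding scheduling_bounded_def .
    from bchoice[OF this] obtain M where
      "\<forall>i\<in>?I. \<forall>T\<ge>0. \<forall>t\<in>{0..T}. (onorm ((*v) (\<Phi> i t)))\<^sup>2 \<le> M i" ..
    then show thesis
      by (intro that[of M]) auto
  qed
  have M_nonneg: "M i \<ge> 0" if "i \<in> ?I" for i
    \<comment> \<open>The bound is evaluated at time 0, where it dominates a square.\<close>
    by (rule order_trans[OF zero_le_power2 M[OF that order_refl]])
  have G_L2e: "G i u \<in> L2e" if "i \<in> ?I" "u \<in> L2e" for i u
    using assms(6)[OF that(1)] that(2) unfolding OSP_def by auto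
  obtain \<beta> \<epsilon> where \<beta>: "\<And>i. i \<in> ?I \<Longrightarrow> \<beta> i \<le> 0" and \<epsilon>: "\<And>i. i \<in> ?I \<Longrightarrow> \<epsilon> i > 0"
    and G_OSP: "\<And>i u T. i \<in> ?I \<Longrightarrow> u \<in> L2e \<Longrightarrow> T \<ge> 0 \<Longrightarrow>
        \<beta> i + \<epsilon> i * (trunc_norm T (G i u))\<^sup>2 \<le> trunc_inner T u (G i u)"
  proof -
    have "\<forall>i\<in>?I. \<exists>b. b \<le> 0 \<and> (\<exists>e>0. \<forall>u\<in>L2e. \<forall>T\<ge>0.
        b + e * (trunc_norm T (G i u))\<^sup>2 \<le> trunc_inner T u (G i u))"
      using assms(6) unfolding OSP_def by blast
    from bchoice[OF this] obtain \<beta> where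
      \<beta>: "\<forall>i\<in>?I. \<beta> i \<le> 0 \<and> (\<exists>e>0. \<forall>u\<in>L2e. \<forall>T\<ge>0.
        \<beta> i + e * (trunc_norm T (G i u))\<^sup>2 \<le> trunc_inner T u (G i u))" ..
    then have "\<forall>i\<in>?I. \<exists>e. e > 0 \<and> (\<forall>u\<in>L2e. \<forall>T\<ge>0.
        \<beta> i + e * (trunc_norm T (G i u))\<^sup>2 \<le> trunc_inner T u (G i u))"
      by blast
    from bchoice[OF this] obtain \<epsilon> where
      "\<forall>i\<in>?I. \<epsilon> i > 0 \<and> (\<forall>u\<in>L2e. \<forall>T\<ge>0.
        \<beta> i + \<epsilon> i * (trunc_norm T (G i u))\<^sup>2 \<le> trunc_inner T u (G i u))" ..
    with \<beta> show thesis
      by (intro that[of \<beta> \<epsilon>]) blast+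
  qed

  \<comment> \<open>The sum dominates each ratio \<open>N * \<alpha> i * M i / \<epsilon> i\<close>,
    which is what the \<open>i\<close>-th term of the output estimate requires. The summand 1 keeps
    \<open>C\<close> positive even if every \<open>M i\<close> vanishes.\<close>
  define C where "C = 1 + (\<Sum>i\<in>?I. N * \<alpha> i * M i / \<epsilon> i)"
  have term_nonneg: "0 \<le> N * \<alpha> i * M i / \<epsilon> i" if "i \<in> ?I" for i
    using \<alpha>[OF that] M_nonneg[OF that] \<epsilon>[OF that] by simp
  have C_pos: "C > 0"
    unfolding C_def by (intro add_pos_nonneg sum_nonneg term_nonneg) auto
  have C: "N * \<alpha> i * M i \<le> C * \<epsilon> i" if "i \<in> ?I" for i
  proof -
    have "N * \<alpha> i * M i / \<epsilon> i \<le> (\<Sum>i\<in>?I. N * \<alpha> i * M i / \<epsilon> i)"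
      by (rule member_le_sum) (use that term_nonneg in auto)
    then have "N * \<alpha> i * M i / \<epsilon> i \<le> C" unfolding C_def by simp
    then show ?thesis using \<epsilon>[OF that] by (simp add: divide_le_eq)
  qed

  \<comment> \<open>The passivity inequality of \<open>G i\<close> may be applied only to inputs in
    \<open>L2e\<close>, so the scheduled input must be shown to lie there.\<close>
  have \<Phi>_L2e: "(\<lambda>s. \<Phi> i s *v u s) \<in> L2e" if i: "i \<in> ?I" and u: "u \<in> L2e" for i u
  proof (rule L2e_I)
    show "piecewise_continuous (\<lambda>s. \<Phi> i s *v u s)"
      by (rule piecewise_continuous_compose2[where h = "(*v)", OF pc[OF i]
            u[THEN L2e_piecewise_continuous]])
        (intro continuous_intros)
    show "(\<lambda>t. M i * (u t \<bullet> u t)) integrable_on {0..T}" if "T \<ge> 0" for T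
      by (intro integrable_on_mult_right L2e_integrable u that)
    show "(\<Phi> i t *v u t) \<bullet> (\<Phi> i t *v u t) \<le> M i * (u t \<bullet> u t)" if "t \<ge> 0" for t
    proof -
      have "(norm (\<Phi> i t *v u t))\<^sup>2 \<le> (onorm ((*v) (\<Phi> i t)) * norm (u t))\<^sup>2"
        by (intro power_mono onorm) auto
      also have "\<dots> \<le> M i * (norm (u t))\<^sup>2"
        unfolding power_mult_distrib by (intro mult_right_mono M i that) auto
      finally show ?thesis by (simp add: dot_square_norm)
    qed
  qed

  define Y where "Y u i = G i (\<lambda>s. \<Phi> i s *v u s)" for u i
  define yc where "yc u = gain_scheduled N \<alpha> \<Phi> G u" for u
  have yc: "yc u t = (\<Sum>i\<in>?I. \<alpha> i *\<^sub>R (transpose (\<Phi> i t) *v Y u i t))" for u t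
    by (simp add: yc_def gain_scheduled_def Y_def)
  have Y_L2e: "Y u i \<in> L2e" if "i \<in> ?I" "u \<in> L2e" for u i
    unfolding Y_def by (intro G_L2e \<Phi>_L2e that)

  have yc_bound: "yc u t \<bullet> yc u t \<le> C * (\<Sum>i\<in>?I. \<alpha> i * \<epsilon> i * (Y u i t \<bullet> Y u i t))"
    if t: "t \<ge> 0" for u t
  proof -
    have *: "N * (norm (\<alpha> i *\<^sub>R (transpose (\<Phi> i t) *v Y u i t)))\<^sup>2
        \<le> C * (\<alpha> i * \<epsilon> i * (norm (Y u i t))\<^sup>2)" if i: "i \<in> ?I" for i
    proof -
      have "(norm (transpose (\<Phi> i t) *v Y u i t))\<^sup>2
          \<le> (onorm ((*v) (\<Phi> i t)) * norm (Y u i t))\<^sup>2"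
        by (intro power_mono norm_transpose_mult_le) auto
      also have "\<dots> \<le> M i * (norm (Y u i t))\<^sup>2"
        unfolding power_mult_distrib by (intro mult_right_mono M i t) auto
      finally have "N * (\<alpha> i)\<^sup>2 * (norm (transpose (\<Phi> i t) *v Y u i t))\<^sup>2
          \<le> N * (\<alpha> i)\<^sup>2 * (M i * (norm (Y u i t))\<^sup>2)"
        by (intro mult_left_mono) auto
      \<comment> \<open>One factor of the square of \<open>\<alpha> i\<close> joins the constant to
        be absorbed by \<open>C * \<epsilon> i\<close>. The other stays as the weight that this term
        carries in the supply rate.\<close>
      also have "\<dots> = (N * \<alpha> i * M i) * (\<alpha> i * (norm (Y u i t))\<^sup>2)"
        by (simp add: power2_eq_square)
      also have "\<dots> \<le> (C * \<epsilon> i) * (\<alpha> i * (norm (Y u i t))\<^sup>2)"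
        using \<alpha>[OF i] by (intro mult_right_mono C i) auto
      finally show ?thesis by (simp add: power_mult_distrib mult_ac)
    qed
    have "yc u t \<bullet> yc u t
        \<le> N * (\<Sum>i\<in>?I. (norm (\<alpha> i *\<^sub>R (transpose (\<Phi> i t) *v Y u i t)))\<^sup>2)"
      using norm_sum_power2_le[of "\<lambda>i. \<alpha> i *\<^sub>R (transpose (\<Phi> i t) *v Y u i t)" ?I]
      by (simp add: yc dot_square_norm)
    also have "\<dots> \<le> C * (\<Sum>i\<in>?I. \<alpha> i * \<epsilon> i * (Y u i t \<bullet> Y u i t))"
      unfolding sum_distrib_left dot_square_norm by (intro sum_mono *)
    finally show ?thesis .
  qed

  have Y_integrable: "(\<lambda>t. \<Sum>i\<in>?I. \<alpha> i * \<epsilon> i * (Y u i t \<bullet> Y u i t)) integrable_on {0..T}"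
    if "u \<in> L2e" "T \<ge> 0" for u T
    by (intro integrable_sum integrable_on_mult_right L2e_integrable Y_L2e that) auto

  have yc_L2e: "yc u \<in> L2e" if u: "u \<in> L2e" for u
  \<comment> \<open>The pointwise estimate \<open>yc_bound\<close> is used twice: here its
    right-hand side is the dominating function for membership in \<open>L2e\<close>, and later it is
    integrated to obtain passivity.\<close>
  proof (rule L2e_I[OF _ integrable_on_mult_right[OF Y_integrable[OF u]] yc_bound])
    have "piecewise_continuous (\<lambda>t. \<alpha> i *\<^sub>R (transpose (\<Phi> i t) *v Y u i t))"
      if i: "i \<in> ?I" for i
      by (rule piecewise_continuous_compose2[where h = "\<lambda>A y. \<alpha> i *\<^sub>R (transpose A *v y)", OF pc[OF i]
            Y_L2e[OF i u, THEN L2e_piecewise_continuous]])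
        (intro continuous_intros)
    then show "piecewise_continuous (yc u)"
      unfolding yc by (rule piecewise_continuous_sum)
  qed

  have supply_rate: "trunc_inner T u (yc u)
      = (\<Sum>i\<in>?I. \<alpha> i * trunc_inner T (\<lambda>s. \<Phi> i s *v u s) (Y u i))"
    if u: "u \<in> L2e" and T: "T \<ge> 0" for u T
  proof -
    have "u t \<bullet> yc u t = (\<Sum>i\<in>?I. \<alpha> i * ((\<Phi> i t *v u t) \<bullet> Y u i t))" for t
      unfolding yc inner_sum_right inner_scaleR_right
      by (simp only: inner_transpose_mult)
    then have "trunc_inner T u (yc u)
        = integral {0..T} (\<lambda>t. \<Sum>i\<in>?I. \<alpha> i * ((\<Phi> i t *v u t) \<bullet> Y u i t))"
      by (simp only: trunc_inner_def)
    also have "\<dots> = (\<Sum>i\<in>?I. integral {0..T} (\<lambda>t. \<alpha> i * ((\<Phi> i t *v u t) \<bullet> Y u i t)))"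
      by (intro integral_sum integrable_on_mult_right L2e_inner_integrable \<Phi>_L2e Y_L2e u T) auto
    finally show ?thesis
      by (simp add: trunc_inner_def)
  qed

  have passivity: "(\<Sum>i\<in>?I. \<alpha> i * \<beta> i) + 1 / C * (trunc_norm T (yc u))\<^sup>2
      \<le> trunc_inner T u (yc u)" if u: "u \<in> L2e" and T: "T \<ge> 0" for u T
  proof -
    have "(trunc_norm T (yc u))\<^sup>2
        \<le> integral {0..T} (\<lambda>t. C * (\<Sum>i\<in>?I. \<alpha> i * \<epsilon> i * (Y u i t \<bullet> Y u i t)))"
      unfolding trunc_norm_power2[OF yc_L2e[OF u] T]
      by (intro integral_le L2e_integrable yc_L2e integrable_on_mult_right Y_integrable u T)
        (use yc_bound in auto)
    also have "\<dots> = C * (\<Sum>i\<in>?I. \<alpha> i * \<epsilon> i * (trunc_norm T (Y u i))\<^sup>2)"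
    proof -
      have "integral {0..T} (\<lambda>t. \<Sum>i\<in>?I. \<alpha> i * \<epsilon> i * (Y u i t \<bullet> Y u i t))
          = (\<Sum>i\<in>?I. integral {0..T} (\<lambda>t. \<alpha> i * \<epsilon> i * (Y u i t \<bullet> Y u i t)))"
        by (intro integral_sum integrable_on_mult_right L2e_integrable Y_L2e u T) auto
      also have "\<dots> = (\<Sum>i\<in>?I. \<alpha> i * \<epsilon> i * (trunc_norm T (Y u i))\<^sup>2)"
        by (intro sum.cong refl) (simp only: trunc_norm_power2[OF Y_L2e[OF _ u] T] integral_mult_right)
      finally show ?thesis
        by (simp only: integral_mult_right)
    qed
    \<comment> \<open>Dividing by \<open>C\<close> leaves exactly the weighted output energies that
      the subcontrollers provide, which explains the index \<open>1 / C\<close>.\<close>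
    finally have "1 / C * (trunc_norm T (yc u))\<^sup>2
        \<le> (\<Sum>i\<in>?I. \<alpha> i * \<epsilon> i * (trunc_norm T (Y u i))\<^sup>2)"
      using C_pos by (simp add: divide_le_eq mult.commute)
    then have "(\<Sum>i\<in>?I. \<alpha> i * \<beta> i) + 1 / C * (trunc_norm T (yc u))\<^sup>2
        \<le> (\<Sum>i\<in>?I. \<alpha> i * (\<beta> i + \<epsilon> i * (trunc_norm T (Y u i))\<^sup>2))"
      by (simp add: sum.distrib distrib_left mult.assoc)
    also have "\<dots> \<le> trunc_inner T u (yc u)"
      unfolding supply_rate[OF u T] Y_def
      \<comment> \<open>Each \<open>G_OSP\<close> inequality is taken at the scheduled input.
        Nonnegative weights \<open>\<alpha> i\<close> preserve its direction under summation, and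
        the offsets combine to the sum of the \<open>\<alpha> i * \<beta> i\<close>.\<close>
      by (intro sum_mono mult_left_mono G_OSP \<Phi>_L2e u T less_imp_le[OF \<alpha>])
    finally show ?thesis .
  qed

  show ?thesis
    unfolding OSP_def
  proof (intro conjI exI ballI allI impI funcsetI)
    show "gain_scheduled N \<alpha> \<Phi> G u \<in> L2e" if "u \<in> L2e" for u
      using yc_L2e[OF that] by (simp add: yc_def)
    show "(\<Sum>i\<in>?I. \<alpha> i * \<beta> i) \<le> 0"
      by (intro sum_nonpos mult_nonneg_nonpos \<beta> less_imp_le[OF \<alpha>])
    show "1 / C > 0" using C_pos by simp
    show "(\<Sum>i\<in>?I. \<alpha> i * \<beta> i) + 1 / C * (trunc_norm T (gain_scheduled N \<alpha> \<Phi> G u))\<^sup>2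
        \<le> trunc_inner T u (gain_scheduled N \<alpha> \<Phi> G u)" if "u \<in> L2e" "T \<ge> 0" for u T
      using passivity[OF that] by (simp add: yc_def)
  qed
qed

end
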